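(* Let $G$ be a connected graph with $N$ vertices and $b$ edges, and let $C^0\in\{0,1\}^{n^c\times b}$, $n^c=b-N+1$, be any undirected cycle basis of $G$. Then the cycle-exchange algorithm described in the context, started from $C^0$, produces a minimum cycle basis of $G$: the output matrix $C$ is a cycle basis of $G$ with the minimum total number of edges $\sum_{\kappa,j}C_{\kappa j}$ among all cycle bases of $G$, and the output $D$ is a directed version of it.
   Context: $G$ is the graph of a power network; branch $j\in[b]$ joins a "from" bus $i^{fr}_j$ and a different "to" bus $i^{to}_j$ (parallel branches may occur). A (simple) cycle is a sequence of distinct vertices with consecutive ones joined by an edge and the last joined back to the first; it is identified with its edge-incidence vector in $\{0,1\}^b$. The cycle space of $G$ is the $\mathbb F_2$-vector space of edge sets in which every vertex has even degree, under addition modulo 2; its dimension is $n^c=b-N+1$. A cycle basis is a set of $n^c$ linearly independent (over $\mathbb F_2$) cycles spanning the cycle space, written as a matrix $C\in\{0,1\}^{n^c\times b}$ with rows $C_\kappa$. A minimum cycle basis is a cycle basis minimizing the total number of edges over its cycles. A directed version of $C$ is a matrix $D\in\{-1,0,1\}^{n^c\times b}$ whose row $\kappa$ is obtained by traversing cycle $C_\kappa$ once around in some direction, with entry $+1$ for edges of the cycle traversed from $i^{fr}$ to $i^{to}$, $-1$ for edges traversed from $i^{to}$ to $i^{fr}$, and $0$ for edges not in the cycle. Integer program for index $\hat\kappa$ and current basis $C$: $$\min_{w,\zeta,v}\ \sum_{j\in[b]}v_j\quad\text{s.t.}\quad\sum_{\kappa\in[n^c]}C_{\kappa j}w_\kappa=2\zeta_j+v_j\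 \ \forall j\in[b],\quad w\in\{0,1\}^{n^c},\ w_{\hat\kappa}=1,\ \zeta\in\mathbb Z^b,\ v\ge0.$$ Algorithm: set $C\leftarrow C^0$, $D\leftarrow 0\in\mathbb{R}^{n^c\times b}$. For $\hat\kappa=1,2,\dots,n^c$ in order: (i) replace row $C_{\hat\kappa}$ by the $v$-component $v^*$ of an optimal solution of the integer program for index $\hat\kappa$ and the current $C$; (ii) traverse the cycle $C_{\hat\kappa}$ through its nodes $(\nu_1,\dots,\nu_{n_{\hat\kappa}})$ with $\nu_{n_{\hat\kappa}}=\nu_1$, and for each $i\in[n_{\hat\kappa}-1]$ let $\varepsilon$ be the branch of the cycle traversed from $\nu_i$ to $\nu_{i+1}$, with $\{\nu_i,\nu_{i+1}\}=\{i^{fr}_\varepsilon,i^{to}_\varepsilon\}$, and set $D_{\hat\kappa,\varepsilon}\leftarrow1$ if $\nu_i=i^{fr}_\varepsilon$ and $-1$ otherwise. Return $C,D$. *)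

theory Defs
  imports
    Complex_Main
    "HOL-Library.Z2"
    "HOL-Library.Function_Algebras"
    "Graph_Theory.Digraph_Component"
begin

text \<open>
  The network is a finite loop-free multigraph, given as a digraph in which every branch \<open>e\<close> is
  oriented from its ``from'' bus \<open>tail G e\<close> to its ``to'' bus \<open>head G e\<close>.  The orientation is
  only a reference direction: cycles and connectivity below are those of the underlying undirected
  multigraph.  The columns of the matrices are indexed by the branches themselves and the rows by
  \<open>{..<cyclomatic G}\<close>; entries outside these ranges are never looked at.
\<close>

definition cyclomatic :: "('v, 'e) pre_digraph \<Rightarrow> nat" where
  \<comment> \<open>\<open>b - N + 1\<close>; no truncation occurs for connected graphs, where \<open>N \<le> b + 1\<close>\<close>
  "cyclomatic G = card (arcs G) + 1 - card (verts G)"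

text \<open>
  A traversal lists the nodes \<open>\<nu>\<^sub>1, \<dots>, \<nu>\<^sub>n = \<nu>\<^sub>1\<close> together with the branches used between them.
  Distinctness of the branches only matters for two nodes joined by parallel branches,
  where it excludes going back along the same branch.
\<close>

definition closed_traversal :: "('v, 'e) pre_digraph \<Rightarrow> 'v list \<Rightarrow> 'e list \<Rightarrow> bool" where
  "closed_traversal G \<nu> es \<longleftrightarrow>
     es \<noteq> [] \<and> length \<nu> = Suc (length es) \<and> hd \<nu> = last \<nu> \<and>
     distinct (butlast \<nu>) \<and> distinct es \<and> set es \<subseteq> arcs G \<and>
     (\<forall>i<length es. {\<nu> ! i, \<nu> ! Suc i} = {tail G (es ! i), head G (es ! i)})"

definition traverses :: "('v, 'e) pre_digraph \<Rightarrow> ('e \<Rightarrow> real) \<Rightarrow> 'v list \<Rightarrow> 'e list \<Rightarrow> bool" where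
  "traverses G x \<nu> es \<longleftrightarrow>
     closed_traversal G \<nu> es \<and> (\<forall>e\<in>arcs G. x e = of_bool (e \<in> set es))"

definition is_cycle :: "('v, 'e) pre_digraph \<Rightarrow> ('e \<Rightarrow> real) \<Rightarrow> bool" where
  "is_cycle G x \<longleftrightarrow> (\<exists>\<nu> es. traverses G x \<nu> es)"

global_interpretation F2: vector_space "\<lambda>(c::bit) (x::'e \<Rightarrow> bit) e. c * x e"
  by unfold_locales (simp_all only: fun_eq_iff plus_fun_def distrib_left distrib_right mult.assoc mult_1_left simp_thms)

definition edge_vec :: "('v, 'e) pre_digraph \<Rightarrow> ('e \<Rightarrow> real) \<Rightarrow> 'e \<Rightarrow> bit" where
  \<comment> \<open>reading a \<open>{0,1}\<close>-row over the two-element field\<close>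
  "edge_vec G x = (\<lambda>e. of_bool (e \<in> arcs G \<and> x e = 1))"

definition cycle_space :: "('v, 'e) pre_digraph \<Rightarrow> ('e \<Rightarrow> bit) set" where
  "cycle_space G =
     {x. (\<forall>e. e \<notin> arcs G \<longrightarrow> x e = 0) \<and>
         (\<forall>u\<in>verts G. even (card {e \<in> arcs G. x e = 1 \<and> (tail G e = u \<or> head G e = u)}))}"

definition cycle_basis :: "('v, 'e) pre_digraph \<Rightarrow> (nat \<Rightarrow> 'e \<Rightarrow> real) \<Rightarrow> bool" where
  "cycle_basis G C \<longleftrightarrow>
     (\<forall>k<cyclomatic G. is_cycle G (C k)) \<and>
     inj_on (\<lambda>k. edge_vec G (C k)) {..<cyclomatic G} \<and>
     F2.independent ((\<lambda>k. edge_vec G (C k)) ` {..<cyclomatic G}) \<and>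
     F2.span ((\<lambda>k. edge_vec G (C k)) ` {..<cyclomatic G}) = cycle_space G"

definition total_edges :: "('v, 'e) pre_digraph \<Rightarrow> (nat \<Rightarrow> 'e \<Rightarrow> real) \<Rightarrow> real" where
  "total_edges G C = (\<Sum>k<cyclomatic G. \<Sum>e\<in>arcs G. C k e)"

definition minimum_cycle_basis :: "('v, 'e) pre_digraph \<Rightarrow> (nat \<Rightarrow> 'e \<Rightarrow> real) \<Rightarrow> bool" where
  "minimum_cycle_basis G C \<longleftrightarrow>
     cycle_basis G C \<and> (\<forall>B. cycle_basis G B \<longrightarrow> total_edges G C \<le> total_edges G B)"

definition directed_version ::
    "('v, 'e) pre_digraph \<Rightarrow> (nat \<Rightarrow> 'e \<Rightarrow> real) \<Rightarrow> (nat \<Rightarrow> 'e \<Rightarrow> real) \<Rightarrow> bool" where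
  "directed_version G C D \<longleftrightarrow>
     (\<forall>k<cyclomatic G. \<exists>\<nu> es. traverses G (C k) \<nu> es \<and>
        (\<forall>i<length es.
           (\<nu> ! i = tail G (es ! i) \<and> \<nu> ! Suc i = head G (es ! i) \<longrightarrow> D k (es ! i) = 1) \<and>
           (\<nu> ! i = head G (es ! i) \<and> \<nu> ! Suc i = tail G (es ! i) \<longrightarrow> D k (es ! i) = -1)) \<and>
        (\<forall>e\<in>arcs G - set es. D k e = 0))"

definition ip_feasible ::
    "('v, 'e) pre_digraph \<Rightarrow> (nat \<Rightarrow> 'e \<Rightarrow> real) \<Rightarrow> nat \<Rightarrow>
     (nat \<Rightarrow> real) \<Rightarrow> ('e \<Rightarrow> int) \<Rightarrow> ('e \<Rightarrow> real) \<Rightarrow> bool" where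
  "ip_feasible G C \<kappa> w \<zeta> v \<longleftrightarrow>
     (\<forall>e\<in>arcs G. (\<Sum>k<cyclomatic G. C k e * w k) = 2 * of_int (\<zeta> e) + v e) \<and>
     (\<forall>k<cyclomatic G. w k \<in> {0, 1}) \<and> w \<kappa> = 1 \<and>
     (\<forall>e\<in>arcs G. 0 \<le> v e)"

definition ip_optimal ::
    "('v, 'e) pre_digraph \<Rightarrow> (nat \<Rightarrow> 'e \<Rightarrow> real) \<Rightarrow> nat \<Rightarrow>
     (nat \<Rightarrow> real) \<Rightarrow> ('e \<Rightarrow> int) \<Rightarrow> ('e \<Rightarrow> real) \<Rightarrow> bool" where
  "ip_optimal G C \<kappa> w \<zeta> v \<longleftrightarrow>
     ip_feasible G C \<kappa> w \<zeta> v \<and>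
     (\<forall>w' \<zeta>' v'. ip_feasible G C \<kappa> w' \<zeta>' v' \<longrightarrow> (\<Sum>e\<in>arcs G. v e) \<le> (\<Sum>e\<in>arcs G. v' e))"

definition set_directions ::
    "('v, 'e) pre_digraph \<Rightarrow> 'v list \<Rightarrow> 'e list \<Rightarrow> ('e \<Rightarrow> real) \<Rightarrow> 'e \<Rightarrow> real" where
  "set_directions G \<nu> es =
     fold (\<lambda>i d. d(es ! i := if \<nu> ! i = tail G (es ! i) then 1 else -1)) [0..<length es]"

text \<open>
  \<open>exchange_state G C0 k C D\<close>: some run of the algorithm started from \<open>C0\<close> holds the matrices
  \<open>C\<close> and \<open>D\<close> after its first \<open>k\<close> iterations.  It is a relation because neither the optimal
  solution of the integer program nor the traversal of the cycle is unique.
\<close>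

inductive exchange_state ::
    "('v, 'e) pre_digraph \<Rightarrow> (nat \<Rightarrow> 'e \<Rightarrow> real) \<Rightarrow> nat \<Rightarrow>
     (nat \<Rightarrow> 'e \<Rightarrow> real) \<Rightarrow> (nat \<Rightarrow> 'e \<Rightarrow> real) \<Rightarrow> bool"
  for G :: "('v, 'e) pre_digraph" and C0 :: "nat \<Rightarrow> 'e \<Rightarrow> real" where
  init: "exchange_state G C0 0 C0 (\<lambda>_ _. 0)"
| step: "exchange_state G C0 (Suc k) (C(k := v)) (D(k := set_directions G \<nu> es (D k)))"
    if "exchange_state G C0 k C D" and "k < cyclomatic G"
      and "ip_optimal G C k w \<zeta> v" and "traverses G v \<nu> es"

definition exchange_output ::
    "('v, 'e) pre_digraph \<Rightarrow> (nat \<Rightarrow> 'e \<Rightarrow> real) \<Rightarrow>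
     (nat \<Rightarrow> 'e \<Rightarrow> real) \<Rightarrow> (nat \<Rightarrow> 'e \<Rightarrow> real) \<Rightarrow> bool" where
  "exchange_output G C0 C D \<longleftrightarrow> exchange_state G C0 (cyclomatic G) C D"

end

theory Submission
  imports Defs
begin

text \<open>
  Read every row over the two-element field, and let \<open>H\<close> be the span of all current rows other than
  row \<open>\<kappa>\<close>, a hyperplane of the cycle space.  Choosing \<open>w\<close> with \<open>w \<kappa> = 1\<close> amounts to choosing an
  element of the cycle space outside \<open>H\<close>, and for a fixed \<open>w\<close> the cheapest nonnegative \<open>v\<close> is the
  parity vector of the integer combination, which is exactly that element.  So the integer program
  asks for a lightest element of the cycle space outside \<open>H\<close>
  (\<open>ip_optimal_lightest_candidate\<close>).

  Such an element \<open>x\<close> is a single cycle (\<open>lightest_outside_subspace_is_cycle\<close>).  Being nonzero with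
  even degrees, its edge set contains a cycle \<open>c\<close>.  If \<open>c\<close> were in \<open>H\<close>, then \<open>x - c\<close> would be
  outside \<open>H\<close> and lighter than \<open>x\<close>; so \<open>c\<close> is outside \<open>H\<close>, and as it is contained in \<open>x\<close> it equals \<open>x\<close>
  by minimality.  Because the new row is not in \<open>H\<close>, replacing row \<open>\<kappa>\<close> by it preserves the basis
  property (\<open>cycle_basis_exchange\<close>), and the algorithm never gets stuck.

  Minimality of the output follows by comparing with an arbitrary cycle basis \<open>B\<close>: after \<open>k\<close>
  iterations there is a basis of the cycle space that contains the first \<open>k\<close> rows and weighs no more
  than \<open>B\<close>.  For the next row \<open>y\<close>, express it in this basis; since \<open>y\<close> is outside \<open>H\<close>, some basis element
  \<open>b\<close> occurring in the expression is outside \<open>H\<close> too.  It may be exchanged for \<open>y\<close>; it weighs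
  at least as much, because \<open>y\<close> is lightest outside \<open>H\<close>; and it is none of the rows already placed,
  because these lie in \<open>H\<close> (\<open>light_extension_exchange\<close>).  After the last iteration, this basis consists
  of the output rows only.
\<close>

section \<open>Exchange in a vector space\<close>

context vector_space
begin

text \<open>
  The Steinitz exchange, with the outgoing vector \<open>b\<close> prescribed: the hypothesis on \<open>v\<close> says that
  \<open>b\<close> occurs in the expression of \<open>v\<close>.
\<close>

lemma basis_exchange:
  assumes "independent S" and "b \<in> S" and "v \<in> span S" and "v \<notin> span (S - {b})"
  shows "independent (insert v (S - {b}))" and "span (insert v (S - {b})) = span S"
proof -
  have S: "insert b (S - {b}) = S"
    using assms(2) by blast
  show "independent (insert v (S - {b}))"
    using assms(1,4) independent_insertI independent_mono by blast
  have "b \<in> span (insert v (S - {b}))"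
    using in_span_insert[of v b "S - {b}"] S assms(3,4) by simp
  then have "S \<subseteq> span (insert v (S - {b}))"
    by (auto intro: span_base)
  moreover have "insert v (S - {b}) \<subseteq> span S"
    using assms(3) by (auto intro: span_base)
  ultimately show "span (insert v (S - {b})) = span S"
    by (simp add: span_eq)
qed

text \<open>
  If all basis vectors occurring in the expression of \<open>v\<close> were in \<open>H\<close>, then \<open>v\<close> would be in \<open>H\<close>.
  The proof takes a smallest \<open>T \<subseteq> S\<close> that spans \<open>v\<close> in place of the set of occurring vectors.
\<close>

lemma exchange_partner_outside_subspace:
  assumes "finite S" and "independent S" and "v \<in> span S" and "subspace H" and "v \<notin> H"
  obtains b where "b \<in> S" and "b \<notin> H" and "v \<notin> span (S - {b})"
proof -
  obtain T where T: "T \<subseteq> S" "v \<in> span T"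
    and least: "\<And>T'. T' \<subseteq> S \<Longrightarrow> v \<in> span T' \<Longrightarrow> card T \<le> card T'"
    using ex_has_least_nat[of "\<lambda>T. T \<subseteq> S \<and> v \<in> span T" S card] assms(3) by blast
  obtain b where b: "b \<in> T" "b \<notin> H"
    using T(2) assms(4,5) span_minimal by blast
  have "finite T"
    using T(1) assms(1) finite_subset by blast
  then have "card (T - {b}) < card T"
    using b(1) by (rule card_Diff1_less)
  then have notin: "v \<notin> span (T - {b})"
    using least[of "T - {b}"] T(1) by fastforce
  have "v \<notin> span (S - {b})"
  proof
    assume v: "v \<in> span (S - {b})"
    \<comment> \<open>Exchanging \<open>v\<close> and \<open>b\<close> inside \<open>T\<close> would make \<open>b\<close> depend on the rest of \<open>S\<close>.\<close>
    have "b \<in> span (insert v (T - {b}))"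
      using in_span_insert[of v b "T - {b}"] T(2) b(1) notin by (simp add: insert_absorb)
    also have "\<dots> \<subseteq> span (insert v (S - {b}))"
      using T(1) by (intro span_mono) blast
    also have "\<dots> = span (S - {b})"
      using v by (rule span_redundant)
    finally show False
      using assms(2) T(1) b(1) unfolding dependent_def by blast
  qed
  then show thesis
    using that b T(1) by blast
qed

end

section \<open>Families of vectors over the two-element field\<close>

text \<open>
  The default rewriting of field operations on \<open>bit\<close> into bit operations hides the ring structure
  from the general lemmas on sums.
\<close>

declare add_bit_eq_xor [simp del] and mult_bit_eq_and [simp del]

lemma sum_bit_eq_parity:
  fixes f :: "'a \<Rightarrow> bit"
  assumes "finite A"
  shows "sum f A = of_bool (odd (card {a \<in> A. f a = 1}))"
  using assms
proof induction
  case (insert a A)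
  have "{b \<in> insert a A. f b = 1} =
      (if f a = 1 then insert a {b \<in> A. f b = 1} else {b \<in> A. f b = 1})"
    by auto
  then show ?case
    using insert by (cases "f a") (auto simp: of_bool_def)
qed simp

lemma sum_fun_at: "(\<Sum>k\<in>K. a k) e = (\<Sum>k\<in>K. a k e)"
  for a :: "'k \<Rightarrow> 'e \<Rightarrow> 'b::comm_monoid_add"
  by (induction K rule: infinite_finite_induct) (auto simp: zero_fun_def)

lemma F2_scale: "(\<lambda>e. c * x e) = (if c = 1 then x else 0)" for c :: bit
  by (cases c) (auto simp: zero_fun_def)

lemma F2_span_subset_sums:
  fixes a :: "'k \<Rightarrow> 'e \<Rightarrow> bit"
  assumes "finite I" and "inj_on a I" and "x \<in> F2.span (a ` I)"
  obtains K where "K \<subseteq> I" and "x = (\<Sum>k\<in>K. a k)"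
proof -
  obtain u where "x = (\<Sum>v\<in>a ` I. (\<lambda>e. u v * v e))"
    using assms F2.span_finite[of "a ` I"] by auto
  also have "\<dots> = (\<Sum>k\<in>I. if u (a k) = 1 then a k else 0)"
    unfolding sum.reindex[OF assms(2)] comp_def by (intro sum.cong refl F2_scale)
  also have "\<dots> = (\<Sum>k\<in>{k \<in> I. u (a k) = 1}. a k)"
    using assms(1) by (simp add: sum.inter_filter)
  finally show thesis
    by (intro that[of "{k \<in> I. u (a k) = 1}"]) auto
qed

text \<open>
  This identifies the constraint \<open>w \<kappa> = 1\<close> of the integer program with lying outside the span of the
  remaining rows.
\<close>

lemma F2_subset_sum_in_hyperplane_iff:
  fixes a :: "'k \<Rightarrow> 'e \<Rightarrow> bit"
  assumes "finite I" and "inj_on a I" and "F2.independent (a ` I)" and "i \<in> I" and "K \<subseteq> I"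
  shows "(\<Sum>k\<in>K. a k) \<in> F2.span (a ` (I - {i})) \<longleftrightarrow> i \<notin> K"
proof (cases "i \<in> K")
  case True
  have "a ` (I - {i}) = a ` I - {a i}"
    using assms(2,4) by (auto simp: inj_on_def)
  then have "a i \<notin> F2.span (a ` (I - {i}))"
    using assms(3,4) unfolding F2.dependent_def by auto
  moreover have "(\<Sum>k\<in>K - {i}. a k) \<in> F2.span (a ` (I - {i}))"
    using assms(5) by (intro F2.span_sum F2.span_base) auto
  moreover have "(\<Sum>k\<in>K. a k) = a i + (\<Sum>k\<in>K - {i}. a k)"
    using True assms(1,5) finite_subset by (intro sum.remove) auto
  ultimately show ?thesis
    using True F2.span_add_eq2 by metis
next
  case False
  then have "(\<Sum>k\<in>K. a k) \<in> F2.span (a ` (I - {i}))"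
    using assms(5) by (intro F2.span_sum F2.span_base imageI) auto
  then show ?thesis
    using False by simp
qed

section \<open>Cycles in loop-free multigraphs\<close>

text \<open>
  The degree condition of the cycle space as a linear map: \<open>boundary G x u\<close> is the degree of \<open>u\<close> in
  the edge set \<open>x\<close> modulo 2, provided that there are no loops.
\<close>

definition boundary :: "('v, 'e) pre_digraph \<Rightarrow> ('e \<Rightarrow> bit) \<Rightarrow> 'v \<Rightarrow> bit" where
  "boundary G x u = (\<Sum>e\<in>{e \<in> arcs G. tail G e = u \<or> head G e = u}. x e)"

definition weight :: "('v, 'e) pre_digraph \<Rightarrow> ('e \<Rightarrow> bit) \<Rightarrow> nat" where
  "weight G x = card {e \<in> arcs G. x e = 1}"

definition edge_set_vec :: "'e set \<Rightarrow> 'e \<Rightarrow> bit" where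
  "edge_set_vec F = (\<lambda>e. of_bool (e \<in> F))"

locale network = fin_digraph G + loopfree_digraph G
  for G :: "('v, 'e) pre_digraph"
begin

lemma cycle_space_iff_boundary:
  "x \<in> cycle_space G \<longleftrightarrow>
     (\<forall>e. e \<notin> arcs G \<longrightarrow> x e = 0) \<and> (\<forall>u\<in>verts G. boundary G x u = 0)"
proof -
  have "boundary G x u = of_bool
      (odd (card {e \<in> arcs G. x e = 1 \<and> (tail G e = u \<or> head G e = u)}))" for u
  proof -
    have "{e \<in> {e \<in> arcs G. tail G e = u \<or> head G e = u}. x e = 1} =
        {e \<in> arcs G. x e = 1 \<and> (tail G e = u \<or> head G e = u)}"
      by blast
    then show ?thesis
      unfolding boundary_def by (subst sum_bit_eq_parity) auto
  qed
  then show ?thesis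
    unfolding cycle_space_def by simp
qed

lemma subspace_cycle_space: "F2.subspace (cycle_space G)"
proof (rule F2.subspaceI)
  show "0 \<in> cycle_space G"
    by (simp add: cycle_space_iff_boundary boundary_def)
  show "x + y \<in> cycle_space G" if "x \<in> cycle_space G" "y \<in> cycle_space G" for x y
    using that by (simp add: cycle_space_iff_boundary boundary_def sum.distrib)
  show "(\<lambda>e. c * x e) \<in> cycle_space G" if "x \<in> cycle_space G" for c x
    using that by (simp add: cycle_space_iff_boundary boundary_def flip: sum_distrib_left)
qed

text \<open>
  The branch between \<open>\<nu> ! i\<close> and \<open>\<nu> ! Suc i\<close> is not a loop, so its incidence with \<open>u\<close> is the
  difference modulo 2 of the indicators of its two ends, and the sum along the closed walk telescopes.
\<close>

lemma closed_traversal_in_cycle_space: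
  assumes "closed_traversal G \<nu> es"
  shows "edge_set_vec (set es) \<in> cycle_space G"
proof -
  note ct = assms[unfolded closed_traversal_def]
  have "boundary G (edge_set_vec (set es)) u = 0" for u
  proof -
    have arc: "es ! i \<in> arcs G" if "i < length es" for i
      using ct that by auto
    have ends: "of_bool (tail G (es ! i) = u \<or> head G (es ! i) = u) =
        (of_bool (\<nu> ! Suc i = u) - of_bool (\<nu> ! i = u) :: bit)" if i: "i < length es" for i
    proof -
      have "\<nu> ! i = tail G (es ! i) \<and> \<nu> ! Suc i = head G (es ! i) \<or>
          \<nu> ! i = head G (es ! i) \<and> \<nu> ! Suc i = tail G (es ! i)"
        using ct i by (metis doubleton_eq_iff)
      then show ?thesis
        using no_loops[OF arc[OF i]] by (elim disjE) auto
    qed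
    have "boundary G (edge_set_vec (set es)) u =
        (\<Sum>e\<in>arcs G. if e \<in> set es then of_bool (tail G e = u \<or> head G e = u) else 0)"
      unfolding boundary_def edge_set_vec_def
      by (subst sum.inter_filter) (auto intro!: sum.cong)
    also have "\<dots> = (\<Sum>e\<in>set es. of_bool (tail G e = u \<or> head G e = u))"
      using ct by (subst sum.inter_restrict[symmetric]) (auto simp: Int_absorb1)
    also have "\<dots> = (\<Sum>i<length es. of_bool (tail G (es ! i) = u \<or> head G (es ! i) = u))"
      using ct by (intro sum.reindex_bij_betw[symmetric] bij_betw_nth) auto
    also have "\<dots> = (\<Sum>i<length es. of_bool (\<nu> ! Suc i = u) - of_bool (\<nu> ! i = u))"
      using ends by (intro sum.cong) auto
    also have "\<dots> = of_bool (\<nu> ! length es = u) - of_bool (\<nu> ! 0 = u)"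
      by (rule sum_lessThan_telescope)
    also have "\<nu> ! length es = \<nu> ! 0"
      using ct by (metis diff_Suc_1 hd_conv_nth last_conv_nth length_0_conv nat.distinct(1))
    finally show ?thesis
      by simp
  qed
  then show ?thesis
    using ct unfolding cycle_space_iff_boundary by (auto simp: edge_set_vec_def)
qed

text \<open>
  The start \<open>u\<close> of a longest path in the support of \<open>x\<close> meets the first branch of the path, hence,
  its degree being even, also a second branch \<open>f\<close> of the support.  The other end of \<open>f\<close> is on the path,
  as the path could otherwise be prolonged, and \<open>f\<close> closes a cycle with the initial part of the path.
\<close>

lemma nonzero_cycle_space_contains_cycle:
  assumes x: "x \<in> cycle_space G" and "x \<noteq> 0"
  obtains \<nu> es where "closed_traversal G \<nu> es" and "\<And>e. e \<in> set es \<Longrightarrow> x e = 1"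
proof -
  let ?F = "{e \<in> arcs G. x e = 1}"
  define path where "path = (\<lambda>(\<nu>, es). length \<nu> = Suc (length es) \<and> distinct \<nu> \<and> distinct es \<and>
     set es \<subseteq> ?F \<and> (\<forall>i<length es. {\<nu> ! i, \<nu> ! Suc i} = {tail G (es ! i), head G (es ! i)}))"
  obtain e where "x e \<noteq> 0"
    using assms(2) by (auto simp: fun_eq_iff)
  moreover from this have "e \<in> arcs G"
    using x unfolding cycle_space_def by blast
  ultimately have e: "e \<in> ?F"
    by simp
  have start: "path ([tail G e, head G e], [e])"
    using e no_loops by (auto simp: path_def)
  have bound: "length (snd p) < Suc (card (arcs G))" if "path p" for p
  proof -
    have "length (snd p) = card (set (snd p))"
      using that by (auto simp: path_def distinct_card)
    also have "\<dots> \<le> card (arcs G)"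
      using that by (intro card_mono) (auto simp: path_def)
    finally show ?thesis
      by simp
  qed
  obtain \<nu> es where p: "path (\<nu>, es)"
    and longest: "\<And>\<nu>' es'. path (\<nu>', es') \<Longrightarrow> length es' \<le> length es"
  proof -
    have "\<exists>p. path p \<and> (\<forall>q. path q \<longrightarrow> length (snd q) \<le> length (snd p))"
      using bound by (intro Lattices_Big.ex_has_greatest_nat[where P = path, OF start]) blast
    then show ?thesis
      using that by fastforce
  qed
  have len: "length \<nu> = Suc (length es)" and d\<nu>: "distinct \<nu>" and des: "distinct es"
    and F: "set es \<subseteq> ?F"
    and ends: "\<And>i. i < length es \<Longrightarrow>
      {\<nu> ! i, \<nu> ! Suc i} = {tail G (es ! i), head G (es ! i)}"
    using p by (auto simp: path_def)
  have pos: "0 < length es"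
    using longest[OF start] by (cases es) auto
  define u where "u = \<nu> ! 0"
  let ?inc = "{e \<in> arcs G. x e = 1 \<and> (tail G e = u \<or> head G e = u)}"
  have e0: "es ! 0 \<in> ?inc"
    using F pos ends[OF pos] by (auto simp: u_def doubleton_eq_iff subset_iff)
  then have "u \<in> verts G"
    by auto
  then have "even (card ?inc)"
    using x by (simp add: cycle_space_def)
  then have "?inc \<noteq> {es ! 0}"
    by (metis is_singletonI is_singleton_altdef odd_one)
  then obtain f where f: "f \<in> ?inc" "f \<noteq> es ! 0"
    using e0 by blast
  obtain y where y: "{y, u} = {tail G f, head G f}" "y \<noteq> u"
    using f(1) no_loops[of f] by (metis (mono_tags, lifting) insert_commute mem_Collect_eq)
  show thesis
  proof (cases "y \<in> set \<nu>")
    case False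
    have "f \<notin> set es"
    proof
      assume "f \<in> set es"
      then obtain i where "i < length es" "es ! i = f"
        by (auto simp: in_set_conv_nth)
      then have "y \<in> {\<nu> ! i, \<nu> ! Suc i}" "i < length \<nu>" "Suc i < length \<nu>"
        using ends[of i] y(1) len by auto
      then show False
        using False by auto
    qed
    moreover have "{(y # \<nu>) ! i, (y # \<nu>) ! Suc i} =
        {tail G ((f # es) ! i), head G ((f # es) ! i)}" if "i < length (f # es)" for i
      using that y(1) ends by (cases i) (auto simp: u_def)
    ultimately have "path (y # \<nu>, f # es)"
      unfolding path_def using False len d\<nu> des F f(1) by auto
    then show thesis
      using longest by fastforce
  next
    case True
    then obtain j where j: "j < length \<nu>" "\<nu> ! j = y"
      by (auto simp: in_set_conv_nth)
    have j0: "0 < j"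
      using j(2) y(2) by (cases j) (auto simp: u_def)
    have jes: "j \<le> length es"
      using j(1) len by simp
    let ?\<nu> = "y # take (Suc j) \<nu>" and ?es = "f # take j es"
    \<comment> \<open>Of the two forms of the node list, one suits indexing and the other \<open>butlast\<close> and \<open>last\<close>.\<close>
    have snoc: "?\<nu> = (y # take j \<nu>) @ [y]"
      using j by (simp add: take_Suc_conv_app_nth)
    have "y \<notin> set (take j \<nu>)"
      using j d\<nu> by (auto simp: in_set_conv_nth nth_eq_iff_index_eq)
    then have "distinct (butlast ?\<nu>)"
      using d\<nu> unfolding snoc butlast_snoc by simp
    moreover have "hd ?\<nu> = last ?\<nu>"
      unfolding snoc by simp
    moreover have "f \<notin> set (take j es)"
    proof
      assume "f \<in> set (take j es)"
      then obtain i where i: "i < length es" "es ! i = f"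
        by (auto simp: in_set_conv_nth)
      \<comment> \<open>A path visits \<open>u = \<nu> ! 0\<close> only once, so only its first branch is incident to \<open>u\<close>.\<close>
      then have "\<nu> ! 0 \<in> {\<nu> ! i, \<nu> ! Suc i}"
        using ends[of i] y(1) by (auto simp: u_def)
      then have "i = 0"
        using d\<nu> len i(1) nth_eq_iff_index_eq[of \<nu> 0] by auto
      then show False
        using i(2) f(2) by simp
    qed
    then have "distinct ?es"
      using des by simp
    moreover have "{?\<nu> ! i, ?\<nu> ! Suc i} = {tail G (?es ! i), head G (?es ! i)}"
      if "i < length ?es" for i
      using that y(1) ends jes by (cases i) (auto simp: u_def)
    ultimately have "closed_traversal G ?\<nu> ?es"
      unfolding closed_traversal_def using F f(1) jes len set_take_subset[of j es] by auto
    moreover have "x e = 1" if "e \<in> set ?es" for e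
      using that F f(1) set_take_subset[of j es] by auto
    ultimately show thesis
      by (rule that)
  qed
qed

text \<open>
  A cycle \<open>c\<close> inside the support of \<open>x\<close> splits \<open>x\<close> into the edge-disjoint parts \<open>c\<close> and \<open>x - c\<close>, one of
  which is outside \<open>H\<close>.  Minimality excludes \<open>x - c\<close>, which has fewer edges, and forces \<open>c = x\<close>.
\<close>

lemma lightest_outside_subspace_is_cycle:
  assumes H: "F2.subspace H" and x: "x \<in> cycle_space G" "x \<notin> H"
    and least: "\<And>y. y \<in> cycle_space G \<Longrightarrow> y \<notin> H \<Longrightarrow> weight G x \<le> weight G y"
  obtains \<nu> es where "closed_traversal G \<nu> es" and "x = edge_set_vec (set es)"
proof -
  have "x \<noteq> 0"
    using x(2) H F2.subspace_0 by blast
  then obtain \<nu> es where ct: "closed_traversal G \<nu> es" and es: "\<And>e. e \<in> set es \<Longrightarrow> x e = 1"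
    using x(1) nonzero_cycle_space_contains_cycle by blast
  let ?c = "edge_set_vec (set es)"
  have arcs: "set es \<subseteq> arcs G" and "es \<noteq> []"
    using ct by (auto simp: closed_traversal_def)
  have c: "?c \<in> cycle_space G"
    using ct by (rule closed_traversal_in_cycle_space)
  have supp_c: "{e \<in> arcs G. ?c e = 1} = set es"
    using arcs by (auto simp: edge_set_vec_def)
  have "?c \<notin> H"
  proof
    assume cH: "?c \<in> H"
    have "x - ?c \<in> cycle_space G"
      using x(1) c subspace_cycle_space by (rule F2.subspace_diff[rotated])
    moreover have "x - ?c \<notin> H"
    proof
      assume "x - ?c \<in> H"
      then have "(x - ?c) + ?c \<in> H"
        using cH H by (intro F2.subspace_add)
      then show False
        using x(2) by simp
    qed
    moreover have "weight G (x - ?c) < weight G x"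
    proof -
      have "{e \<in> arcs G. (x - ?c) e = 1} = {e \<in> arcs G. x e = 1} - set es"
        using es by (auto simp: edge_set_vec_def)
      also have "\<dots> \<subset> {e \<in> arcs G. x e = 1}"
        using es arcs \<open>es \<noteq> []\<close> by (cases es) auto
      finally show ?thesis
        unfolding weight_def by (intro psubset_card_mono) auto
    qed
    ultimately show False
      using least by fastforce
  qed
  then have "card {e \<in> arcs G. x e = 1} \<le> card (set es)"
    using least[OF c] supp_c by (simp add: weight_def)
  moreover have "set es \<subseteq> {e \<in> arcs G. x e = 1}"
    using es arcs by blast
  ultimately have eq: "set es = {e \<in> arcs G. x e = 1}"
    by (intro card_seteq) auto
  have "x e = ?c e" for e
    using x(1) eq by (cases "x e") (auto simp: edge_set_vec_def cycle_space_def)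
  then show thesis
    using that[OF ct] by blast
qed

section \<open>The integer program\<close>

lemma cycle_row_entry:
  assumes "is_cycle G x" and "e \<in> arcs G"
  shows "x e = of_bool (edge_vec G x e = 1)"
  using assms by (auto simp: is_cycle_def traverses_def edge_vec_def)

lemma sum_indicator_eq_weight:
  "(\<Sum>e\<in>arcs G. of_bool (y e = 1)) = real (weight G y)"
  by (simp add: weight_def Int_def)

lemma sum_cycle_row:
  assumes "is_cycle G x"
  shows "(\<Sum>e\<in>arcs G. x e) = real (weight G (edge_vec G x))"
proof -
  have "(\<Sum>e\<in>arcs G. x e) = (\<Sum>e\<in>arcs G. of_bool (edge_vec G x e = 1))"
    using assms cycle_row_entry by (intro sum.cong) auto
  then show ?thesis
    by (simp only: sum_indicator_eq_weight)
qed

text \<open>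
  The possible new rows \<open>\<kappa>\<close>: when \<open>C\<close> is a cycle basis, exactly the vectors that can replace
  row \<open>\<kappa>\<close> and leave a basis of the cycle space.
\<close>

definition candidates :: "(nat \<Rightarrow> 'e \<Rightarrow> real) \<Rightarrow> nat \<Rightarrow> ('e \<Rightarrow> bit) set" where
  "candidates C \<kappa> =
     cycle_space G - F2.span ((\<lambda>k. edge_vec G (C k)) ` ({..<cyclomatic G} - {\<kappa>}))"

lemma old_row_is_candidate:
  assumes "cycle_basis G C" and "\<kappa> < cyclomatic G"
  shows "edge_vec G (C \<kappa>) \<in> candidates C \<kappa>"
proof -
  have "edge_vec G (C \<kappa>) \<in> F2.span ((\<lambda>k. edge_vec G (C k)) ` {..<cyclomatic G})"
    using assms(2) by (intro F2.span_base imageI) simp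
  then have "edge_vec G (C \<kappa>) \<in> cycle_space G"
    using assms(1) by (simp add: cycle_basis_def)
  moreover have "(\<Sum>k\<in>{\<kappa>}. edge_vec G (C k)) \<notin>
      F2.span ((\<lambda>k. edge_vec G (C k)) ` ({..<cyclomatic G} - {\<kappa>}))"
    using assms by (subst F2_subset_sum_in_hyperplane_iff) (auto simp: cycle_basis_def)
  ultimately show ?thesis
    by (simp add: candidates_def)
qed

text \<open>
  The left-hand side of the constraint for branch \<open>e\<close> counts the selected rows that contain \<open>e\<close>;
  modulo 2 this is the entry at \<open>e\<close> of the sum of these rows over the two-element field.
\<close>

lemma integer_combination_parity:
  assumes "cycle_basis G C" and "K \<subseteq> {..<cyclomatic G}" and "e \<in> arcs G"
    and w: "\<And>k. k < cyclomatic G \<Longrightarrow> w k = of_bool (k \<in> K)"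
  obtains m :: nat where "(\<Sum>k<cyclomatic G. C k e * w k) = real m"
    and "(\<Sum>k\<in>K. edge_vec G (C k)) e = of_bool (odd m)"
proof
  let ?S = "{k \<in> K. edge_vec G (C k) e = 1}"
  have "(\<Sum>k<cyclomatic G. C k e * w k) = (\<Sum>k<cyclomatic G. of_bool (k \<in> ?S))"
  proof (intro sum.cong refl)
    fix k assume k: "k \<in> {..<cyclomatic G}"
    then have "is_cycle G (C k)"
      using assms(1) by (simp add: cycle_basis_def)
    then have "C k e = of_bool (edge_vec G (C k) e = 1)"
      using assms(3) by (rule cycle_row_entry)
    then show "C k e * w k = of_bool (k \<in> ?S)"
      using w[of k] k by (cases "edge_vec G (C k) e") auto
  qed
  also have "\<dots> = real (card ?S)"
    using assms(2) by (simp add: Int_absorb1 subset_iff)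
  finally show "(\<Sum>k<cyclomatic G. C k e * w k) = real (card ?S)" .
  show "(\<Sum>k\<in>K. edge_vec G (C k)) e = of_bool (odd (card ?S))"
    unfolding sum_fun_at using assms(2) finite_subset by (intro sum_bit_eq_parity) blast
qed

lemma candidate_feasible:
  assumes C: "cycle_basis G C" and \<kappa>: "\<kappa> < cyclomatic G" and y: "y \<in> candidates C \<kappa>"
  obtains w \<zeta> where "ip_feasible G C \<kappa> w \<zeta> (\<lambda>e. of_bool (y e = 1))"
proof -
  let ?a = "\<lambda>k. edge_vec G (C k)"
  obtain K where K: "K \<subseteq> {..<cyclomatic G}" "y = (\<Sum>k\<in>K. ?a k)"
    using F2_span_subset_sums[of "{..<cyclomatic G}" ?a y] C y
    by (auto simp: cycle_basis_def candidates_def)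
  have "\<kappa> \<in> K"
    using F2_subset_sum_in_hyperplane_iff[of "{..<cyclomatic G}" ?a \<kappa> K] C y \<kappa> K
    by (auto simp: cycle_basis_def candidates_def)
  define w :: "nat \<Rightarrow> real" where "w = (\<lambda>k. of_bool (k \<in> K))"
  have "\<exists>z. (\<Sum>k<cyclomatic G. C k e * w k) = 2 * real_of_int z + of_bool (y e = 1)"
    if e: "e \<in> arcs G" for e
  proof -
    obtain m where m: "(\<Sum>k<cyclomatic G. C k e * w k) = real m" "y e = of_bool (odd m)"
      using integer_combination_parity[OF C K(1) e, of w] K(2) unfolding w_def by blast
    have "real m = 2 * real_of_int (int (m div 2)) + real (m mod 2)"
      by (metis mult_div_mod_eq of_int_of_nat_eq of_nat_add of_nat_mult of_nat_numeral)
    then show ?thesis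
      using m by (intro exI[of _ "int (m div 2)"]) (simp add: mod_2_eq_odd)
  qed
  then obtain \<zeta> where "\<And>e. e \<in> arcs G \<Longrightarrow>
      (\<Sum>k<cyclomatic G. C k e * w k) = 2 * real_of_int (\<zeta> e) + of_bool (y e = 1)"
    by metis
  then have "ip_feasible G C \<kappa> w \<zeta> (\<lambda>e. of_bool (y e = 1))"
    using \<open>\<kappa> \<in> K\<close> by (simp add: ip_feasible_def w_def)
  then show thesis
    by (rule that)
qed

text \<open>
  A feasible \<open>v e\<close> is a nonnegative integer that has the parity of the number of selected rows through
  \<open>e\<close>, hence at least 1 where this number is odd.
\<close>

lemma feasible_above_candidate:
  assumes C: "cycle_basis G C" and \<kappa>: "\<kappa> < cyclomatic G" and f: "ip_feasible G C \<kappa> w \<zeta> v"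
  obtains y where "y \<in> candidates C \<kappa>" and "\<And>e. e \<in> arcs G \<Longrightarrow> of_bool (y e = 1) \<le> v e"
proof -
  let ?a = "\<lambda>k. edge_vec G (C k)"
  define K where "K = {k. k < cyclomatic G \<and> w k = 1}"
  have K: "K \<subseteq> {..<cyclomatic G}" and "\<kappa> \<in> K"
    using f \<kappa> by (auto simp: K_def ip_feasible_def)
  have w: "w k = of_bool (k \<in> K)" if "k < cyclomatic G" for k
    using f that by (auto simp: K_def ip_feasible_def)
  let ?y = "\<Sum>k\<in>K. ?a k"
  have "?y \<in> F2.span (?a ` {..<cyclomatic G})"
    using K by (intro F2.span_sum F2.span_base imageI) auto
  moreover have "?y \<notin> F2.span (?a ` ({..<cyclomatic G} - {\<kappa>}))"
    using F2_subset_sum_in_hyperplane_iff[of "{..<cyclomatic G}" ?a \<kappa> K] C \<kappa> K \<open>\<kappa> \<in> K\<close>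
    by (simp add: cycle_basis_def)
  ultimately have "?y \<in> candidates C \<kappa>"
    using C by (simp add: candidates_def cycle_basis_def)
  moreover have "of_bool (?y e = 1) \<le> v e" if e: "e \<in> arcs G" for e
  proof -
    obtain m where m: "(\<Sum>k<cyclomatic G. C k e * w k) = real m" "?y e = of_bool (odd m)"
      using integer_combination_parity[OF C K e w] by blast
    have v: "v e = real_of_int (int m - 2 * \<zeta> e)" "0 \<le> v e"
      using f e m(1) by (auto simp: ip_feasible_def)
    then have "0 \<le> int m - 2 * \<zeta> e"
      by linarith
    then have "of_bool (odd m) \<le> int m - 2 * \<zeta> e"
      unfolding of_bool_def by presburger
    then show ?thesis
      using m(2) v(1) by (auto split: if_splits)
  qed
  ultimately show thesis
    by (rule that)
qed

lemma ip_optimal_exists: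
  assumes C: "cycle_basis G C" and \<kappa>: "\<kappa> < cyclomatic G"
  shows "\<exists>w \<zeta> v. ip_optimal G C \<kappa> w \<zeta> v"
proof -
  obtain y where y: "y \<in> candidates C \<kappa>"
    and least: "\<And>z. z \<in> candidates C \<kappa> \<Longrightarrow> weight G y \<le> weight G z"
    using ex_has_least_nat[of "\<lambda>y. y \<in> candidates C \<kappa>" _ "weight G"]
      old_row_is_candidate[OF assms] by blast
  obtain w \<zeta> where feas: "ip_feasible G C \<kappa> w \<zeta> (\<lambda>e. of_bool (y e = 1))"
    using candidate_feasible[OF assms y] by blast
  have "(\<Sum>e\<in>arcs G. of_bool (y e = 1)) \<le> (\<Sum>e\<in>arcs G. v e)"
    if f: "ip_feasible G C \<kappa> w' \<zeta>' v" for w' \<zeta>' v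
  proof -
    obtain z where z: "z \<in> candidates C \<kappa>" "\<And>e. e \<in> arcs G \<Longrightarrow> of_bool (z e = 1) \<le> v e"
      using feasible_above_candidate[OF assms f] by blast
    have "(\<Sum>e\<in>arcs G. of_bool (y e = 1)) \<le> (\<Sum>e\<in>arcs G. of_bool (z e = 1) :: real)"
      unfolding sum_indicator_eq_weight using least[OF z(1)] by simp
    also have "\<dots> \<le> (\<Sum>e\<in>arcs G. v e)"
      using z(2) by (rule sum_mono)
    finally show ?thesis .
  qed
  with feas have "ip_optimal G C \<kappa> w \<zeta> (\<lambda>e. of_bool (y e = 1))"
    unfolding ip_optimal_def by blast
  then show ?thesis
    by blast
qed

text \<open>
  By \<open>candidate_feasible\<close> and \<open>feasible_above_candidate\<close> the optimal value is the least weight of a candidate.  The candidate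
  below an optimal \<open>v\<close> attains this value too, so \<open>v\<close> agrees with it on every branch.
\<close>

lemma ip_optimal_lightest_candidate:
  assumes C: "cycle_basis G C" and \<kappa>: "\<kappa> < cyclomatic G" and opt: "ip_optimal G C \<kappa> w \<zeta> v"
  shows "edge_vec G v \<in> candidates C \<kappa>"
    and "\<And>z. z \<in> candidates C \<kappa> \<Longrightarrow> weight G (edge_vec G v) \<le> weight G z"
    and "is_cycle G v"
proof -
  have f: "ip_feasible G C \<kappa> w \<zeta> v"
    using opt by (simp add: ip_optimal_def)
  obtain y where y: "y \<in> candidates C \<kappa>" "\<And>e. e \<in> arcs G \<Longrightarrow> of_bool (y e = 1) \<le> v e"
    using feasible_above_candidate[OF C \<kappa> f] by blast
  have opt_le: "(\<Sum>e\<in>arcs G. v e) \<le> real (weight G z)" if z: "z \<in> candidates C \<kappa>" for z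
    using candidate_feasible[OF C \<kappa> z] opt unfolding ip_optimal_def sum_indicator_eq_weight[symmetric]
    by blast
  have le: "real (weight G y) \<le> (\<Sum>e\<in>arcs G. v e)"
    unfolding sum_indicator_eq_weight[symmetric] using y(2) by (rule sum_mono)
  have "(\<Sum>e\<in>arcs G. of_bool (y e = 1)) = (\<Sum>e\<in>arcs G. v e)"
    using opt_le[OF y(1)] le by (simp only: sum_indicator_eq_weight)
  then have v: "v e = of_bool (y e = 1)" if "e \<in> arcs G" for e
    using sum_mono_inv[of "\<lambda>e. of_bool (y e = 1)" "arcs G" v e] y(2) that by simp
  have "y e = 0" if "e \<notin> arcs G" for e
    using y(1) that by (simp add: candidates_def cycle_space_def)
  then have "edge_vec G v e = y e" for e
    using v[of e] by (cases "e \<in> arcs G"; cases "y e") (simp_all add: edge_vec_def)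
  then have ev: "edge_vec G v = y"
    by blast
  have least: "weight G y \<le> weight G z" if "z \<in> candidates C \<kappa>" for z
    using opt_le[OF that] le by linarith
  show "edge_vec G v \<in> candidates C \<kappa>"
    and "\<And>z. z \<in> candidates C \<kappa> \<Longrightarrow> weight G (edge_vec G v) \<le> weight G z"
    using ev y(1) least by auto
  obtain \<nu> es where "closed_traversal G \<nu> es" "y = edge_set_vec (set es)"
    using lightest_outside_subspace_is_cycle[OF F2.subspace_span, of y] y(1) least
    unfolding candidates_def by blast
  then have "traverses G v \<nu> es"
    using v by (auto simp: traverses_def edge_set_vec_def)
  then show "is_cycle G v"
    unfolding is_cycle_def by blast
qed

section \<open>Invariants of the exchange algorithm\<close>

lemma cycle_basis_exchange:
  assumes C: "cycle_basis G C" and \<kappa>: "\<kappa> < cyclomatic G"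
    and v: "is_cycle G v" "edge_vec G v \<in> candidates C \<kappa>"
  shows "cycle_basis G (C(\<kappa> := v))"
proof -
  let ?I = "{..<cyclomatic G}" and ?a = "\<lambda>k. edge_vec G (C k)" and ?y = "edge_vec G v"
  let ?a' = "\<lambda>k. edge_vec G ((C(\<kappa> := v)) k)"
  have inj: "inj_on ?a ?I" and ind: "F2.independent (?a ` ?I)"
    and span: "F2.span (?a ` ?I) = cycle_space G"
    using C by (auto simp: cycle_basis_def)
  have rest: "?a ` ?I - {?a \<kappa>} = ?a ` (?I - {\<kappa>})"
    using inj \<kappa> by (auto simp: inj_on_def)
  have I: "?I = insert \<kappa> (?I - {\<kappa>})"
    using \<kappa> by auto
  have same: "?a' ` (?I - {\<kappa>}) = ?a ` (?I - {\<kappa>})"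
    by (intro image_cong) auto
  have img: "?a' ` ?I = insert ?y (?a ` (?I - {\<kappa>}))"
    by (subst I) (simp only: image_insert same, simp)
  have y: "?y \<in> F2.span (?a ` ?I)" "?y \<notin> F2.span (?a ` (?I - {\<kappa>}))"
    using v(2) span by (auto simp: candidates_def)
  note exch = F2.basis_exchange[of "?a ` ?I" "?a \<kappa>" ?y, unfolded rest, OF ind _ y]
  have "inj_on ?a' (?I - {\<kappa>})"
    using inj by (auto simp: inj_on_def)
  moreover have "?y \<notin> ?a ` (?I - {\<kappa>})"
    using y(2) F2.span_base[of ?y "?a ` (?I - {\<kappa>})"] by blast
  ultimately have "inj_on ?a' ?I"
    by (subst I, subst inj_on_insert) (simp add: same)
  moreover have "F2.independent (?a' ` ?I)" "F2.span (?a' ` ?I) = cycle_space G"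
    unfolding img using exch \<kappa> span by auto
  ultimately show ?thesis
    using C v(1) by (simp add: cycle_basis_def)
qed

text \<open>
  The comparison bases of the minimality argument, which contain the first \<open>k\<close> rows of \<open>C\<close> and weigh at
  most \<open>t\<close>.  They are kept as sets because the position of the exchanged vector in the basis compared
  with is unrelated to the row that replaces it.
\<close>

definition light_extension :: "(nat \<Rightarrow> 'e \<Rightarrow> real) \<Rightarrow> nat \<Rightarrow> real \<Rightarrow> ('e \<Rightarrow> bit) set \<Rightarrow> bool" where
  "light_extension C k t S \<longleftrightarrow>
     finite S \<and> F2.independent S \<and> F2.span S = cycle_space G \<and>
     (\<forall>i<k. edge_vec G (C i) \<in> S) \<and> real (\<Sum>x\<in>S. weight G x) \<le> t"

lemma total_edges_eq_weight:
  assumes "cycle_basis G B"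
  shows "total_edges G B =
    real (\<Sum>x\<in>(\<lambda>k. edge_vec G (B k)) ` {..<cyclomatic G}. weight G x)"
  using assms sum_cycle_row
  by (simp add: total_edges_def cycle_basis_def sum.reindex)

lemma cycle_basis_light_extension:
  assumes "cycle_basis G B"
  shows "light_extension C 0 (total_edges G B) ((\<lambda>k. edge_vec G (B k)) ` {..<cyclomatic G})"
  using assms total_edges_eq_weight[OF assms] by (simp add: light_extension_def cycle_basis_def)

text \<open>
  Here the optimality of the new row is compared with the vector \<open>b\<close> that leaves the comparison basis.
  The already placed rows survive because they lie in the hyperplane that \<open>b\<close> avoids.
\<close>

lemma light_extension_exchange:
  assumes C: "cycle_basis G C" and \<kappa>: "\<kappa> < cyclomatic G"
    and opt: "ip_optimal G C \<kappa> w \<zeta> v" and S: "light_extension C \<kappa> t S"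
  obtains S' where "light_extension (C(\<kappa> := v)) (Suc \<kappa>) t S'"
proof -
  let ?H = "F2.span ((\<lambda>k. edge_vec G (C k)) ` ({..<cyclomatic G} - {\<kappa>}))"
  let ?y = "edge_vec G v"
  note S = S[unfolded light_extension_def]
  note y = ip_optimal_lightest_candidate[OF C \<kappa> opt]
  have "?y \<in> F2.span S" "?y \<notin> ?H"
    using y(1) S by (auto simp: candidates_def)
  then obtain b where b: "b \<in> S" "b \<notin> ?H" "?y \<notin> F2.span (S - {b})"
    using F2.exchange_partner_outside_subspace[of S ?y ?H] S F2.subspace_span by blast
  let ?S' = "insert ?y (S - {b})"
  have "b \<in> candidates C \<kappa>"
    using b S F2.span_base[of b S] by (simp add: candidates_def)
  then have "weight G ?y \<le> weight G b"
    by (rule y(2))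
  moreover have "?y \<notin> S - {b}"
    using b(3) F2.span_base[of ?y "S - {b}"] by blast
  ultimately have "(\<Sum>x\<in>?S'. weight G x) \<le> (\<Sum>x\<in>S. weight G x)"
    using S b(1) by (simp add: sum.remove[of S b])
  moreover have "edge_vec G (C i) \<in> S - {b}" if "i < \<kappa>" for i
  proof -
    have "edge_vec G (C i) \<in> ?H"
      using that \<kappa> by (intro F2.span_base imageI) auto
    then show ?thesis
      using S b(2) that by auto
  qed
  moreover have "F2.independent ?S'" "F2.span ?S' = cycle_space G"
    using F2.basis_exchange[of S b ?y] S b \<open>?y \<in> F2.span S\<close> by auto
  ultimately have "light_extension (C(\<kappa> := v)) (Suc \<kappa>) t ?S'"
    using S by (auto simp: light_extension_def less_Suc_eq simp del: of_nat_sum)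
  then show thesis
    by (rule that)
qed

text \<open>
  A basis that contains a basis is equal to it.
\<close>

lemma light_extension_of_all_rows:
  assumes C: "cycle_basis G C" and S: "light_extension C (cyclomatic G) t S"
  shows "total_edges G C \<le> t"
proof -
  let ?A = "(\<lambda>k. edge_vec G (C k)) ` {..<cyclomatic G}"
  have "?A \<subseteq> S"
    using S by (auto simp: light_extension_def)
  moreover have "S \<subseteq> ?A"
  proof
    fix x assume x: "x \<in> S"
    show "x \<in> ?A"
    proof (rule ccontr)
      assume "x \<notin> ?A"
      then have "F2.span ?A \<subseteq> F2.span (S - {x})"
        using \<open>?A \<subseteq> S\<close> by (intro F2.span_mono) auto
      then have "x \<in> F2.span (S - {x})"
        using x S C F2.span_base[of x S] by (auto simp: light_extension_def cycle_basis_def)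
      then show False
        using x S unfolding light_extension_def F2.dependent_def by blast
    qed
  qed
  ultimately have "?A = S"
    by blast
  then show ?thesis
    using S total_edges_eq_weight[OF C] by (simp add: light_extension_def)
qed

lemma set_directions_entry:
  assumes "distinct es"
  shows "i < length es \<Longrightarrow>
      set_directions G \<nu> es d (es ! i) = (if \<nu> ! i = tail G (es ! i) then 1 else -1)"
    and "e \<notin> set es \<Longrightarrow> set_directions G \<nu> es d e = d e"
proof -
  let ?step = "\<lambda>i d. d(es ! i := if \<nu> ! i = tail G (es ! i) then 1 else -1)"
  have "n \<le> length es \<Longrightarrow>
      (\<forall>i<n. fold ?step [0..<n] d (es ! i) = (if \<nu> ! i = tail G (es ! i) then 1 else -1)) \<and>
      (\<forall>e. e \<notin> set es \<longrightarrow> fold ?step [0..<n] d e = d e)" for n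
  proof (induction n)
    case (Suc n)
    then show ?case
      using assms by (auto simp: less_Suc_eq nth_eq_iff_index_eq)
  qed simp
  from this[of "length es"]
  show "i < length es \<Longrightarrow>
      set_directions G \<nu> es d (es ! i) = (if \<nu> ! i = tail G (es ! i) then 1 else -1)"
    and "e \<notin> set es \<Longrightarrow> set_directions G \<nu> es d e = d e"
    by (auto simp: set_directions_def)
qed

text \<open>
  The requirement of \<open>directed_version\<close> on a single row, so that it can be followed through the
  iterations.
\<close>

definition directed_row :: "('e \<Rightarrow> real) \<Rightarrow> ('e \<Rightarrow> real) \<Rightarrow> bool" where
  "directed_row x d \<longleftrightarrow> (\<exists>\<nu> es. traverses G x \<nu> es \<and>
     (\<forall>i<length es.
        (\<nu> ! i = tail G (es ! i) \<and> \<nu> ! Suc i = head G (es ! i) \<longrightarrow> d (es ! i) = 1) \<and>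
        (\<nu> ! i = head G (es ! i) \<and> \<nu> ! Suc i = tail G (es ! i) \<longrightarrow> d (es ! i) = -1)) \<and>
     (\<forall>e\<in>arcs G - set es. d e = 0))"

text \<open>
  A branch traversed from its head gets \<open>-1\<close> because, without loops, its head is not its tail.
\<close>

lemma set_directions_directed_row:
  assumes "traverses G v \<nu> es"
  shows "directed_row v (set_directions G \<nu> es (\<lambda>_. 0))"
proof -
  have "distinct es" and arcs: "set es \<subseteq> arcs G"
    using assms by (auto simp: traverses_def closed_traversal_def)
  note entry = set_directions_entry[OF this(1)]
  have ends: "tail G (es ! i) \<noteq> head G (es ! i)" if "i < length es" for i
    using arcs that no_loops nth_mem by blast
  have "set_directions G \<nu> es (\<lambda>_. 0) (es ! i) = 1"
    if "i < length es" "\<nu> ! i = tail G (es ! i)" for i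
    using entry(1) that by simp
  moreover have "set_directions G \<nu> es (\<lambda>_. 0) (es ! i) = -1"
    if "i < length es" "\<nu> ! i = head G (es ! i)" for i
    using entry(1) ends[of i] that by simp
  ultimately show ?thesis
    unfolding directed_row_def using assms entry(2) by blast
qed

text \<open>
  The last conjunct is needed because \<open>set_directions\<close> overwrites only the entries on the cycle:
  the others must still be zero when the row is processed.
\<close>

lemma exchange_state_invariants:
  assumes "exchange_state G C0 k C D" and "cycle_basis G C0"
  shows "cycle_basis G C \<and>
    (\<forall>B. cycle_basis G B \<longrightarrow> (\<exists>S. light_extension C k (total_edges G B) S)) \<and>
    (\<forall>i<k. directed_row (C i) (D i)) \<and> (\<forall>i\<ge>k. D i = (\<lambda>_. 0))"
  using assms(1)
proof induction
  case init
  then show ?case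
    using assms(2) cycle_basis_light_extension by auto
next
  case (step k C D w \<zeta> v \<nu> es)
  then have C: "cycle_basis G C"
    by blast
  note opt = ip_optimal_lightest_candidate[OF C step.hyps(2,3)]
  have "cycle_basis G (C(k := v))"
    using cycle_basis_exchange[OF C step.hyps(2) opt(3,1)] .
  moreover have "\<exists>S. light_extension (C(k := v)) (Suc k) (total_edges G B) S"
    if "cycle_basis G B" for B
    using that step.IH light_extension_exchange[OF C step.hyps(2,3)] by metis
  moreover have "directed_row v (set_directions G \<nu> es (D k))"
    using step.IH set_directions_directed_row[OF step.hyps(4)] by simp
  then have "\<forall>i<Suc k. directed_row ((C(k := v)) i) ((D(k := set_directions G \<nu> es (D k))) i)"
    using step.IH by (auto simp: less_Suc_eq)
  moreover have "\<forall>i\<ge>Suc k. (D(k := set_directions G \<nu> es (D k))) i = (\<lambda>_. 0)"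
    using step.IH by simp
  ultimately show ?case
    by blast
qed

lemma exchange_state_exists:
  assumes "cycle_basis G C0" and "k \<le> cyclomatic G"
  shows "\<exists>C D. exchange_state G C0 k C D"
  using assms(2)
proof (induction k)
  case 0
  show ?case
    using exchange_state.init by blast
next
  case (Suc k)
  then obtain C D where st: "exchange_state G C0 k C D"
    by auto
  have k: "k < cyclomatic G"
    using Suc.prems by simp
  have C: "cycle_basis G C"
    using exchange_state_invariants[OF st assms(1)] by blast
  obtain w \<zeta> v where opt: "ip_optimal G C k w \<zeta> v"
    using ip_optimal_exists[OF C k] by blast
  obtain \<nu> es where "traverses G v \<nu> es"
    using ip_optimal_lightest_candidate(3)[OF C k opt] unfolding is_cycle_def by blast
  then show ?case
    using exchange_state.step[OF st k opt] by blast
qed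

lemma exchange_output_correct:
  assumes "cycle_basis G C0" and "exchange_output G C0 C D"
  shows "minimum_cycle_basis G C" and "directed_version G C D"
proof -
  note inv = exchange_state_invariants[OF assms(2)[unfolded exchange_output_def] assms(1)]
  show "minimum_cycle_basis G C"
    unfolding minimum_cycle_basis_def
    using inv light_extension_of_all_rows by blast
  show "directed_version G C D"
    using inv unfolding directed_version_def directed_row_def by blast
qed

end

theorem proposition6:
  fixes G :: "('v, 'e) pre_digraph" and C0 :: "nat \<Rightarrow> 'e \<Rightarrow> real"
  assumes "fin_digraph G" and "loopfree_digraph G" and "Digraph_Component.connected G"
    and "cycle_basis G C0"
  shows
    "(\<forall>k C D. exchange_state G C0 k C D \<and> k < cyclomatic G \<longrightarrow>
        (\<exists>w \<zeta> v. ip_optimal G C k w \<zeta> v) \<and>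
        (\<forall>w \<zeta> v. ip_optimal G C k w \<zeta> v \<longrightarrow> is_cycle G v)) \<and>
     (\<exists>C D. exchange_output G C0 C D) \<and>
     (\<forall>C D. exchange_output G C0 C D \<longrightarrow>
        minimum_cycle_basis G C \<and> directed_version G C D)"
proof -
  interpret network G
    using assms(1,2) by (rule network.intro)
  show ?thesis
  proof (intro conjI allI impI)
    fix k C D
    assume st: "exchange_state G C0 k C D \<and> k < cyclomatic G"
    then have C: "cycle_basis G C"
      using exchange_state_invariants assms(4) by blast
    show "\<exists>w \<zeta> v. ip_optimal G C k w \<zeta> v"
      using C st by (intro ip_optimal_exists) auto
    show "is_cycle G v" if "ip_optimal G C k w \<zeta> v" for w \<zeta> v
      using ip_optimal_lightest_candidate(3)[OF C _ that] st by blast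
  next
    show "\<exists>C D. exchange_output G C0 C D"
      using exchange_state_exists[OF assms(4) order_refl] by (simp add: exchange_output_def)
  next
    fix C D
    assume "exchange_output G C0 C D"
    from exchange_output_correct[OF assms(4) this]
    show "minimum_cycle_basis G C" and "directed_version G C D"
      by auto
  qed
qed

end
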